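(* Let $k\in\mathbb N_+$, $\theta\in[-1,1]$, $L=\lceil\frac{k+3}2\rceil$, and let $Q\ge\frac{k+1}2$ be an integer. Let $$(\mathrm{A}_0):\ \ \langle p\rangle_\Omega=\overline\omega_{\star,0}\big[\langle p\rangle_\Omega^x+\langle p\rangle_\Omega^y\big]+\sum_{s=1}^{S_0}\omega_0^{(s)}\,\overline{p(x_0^{(s)},y_0^{(s)})}\qquad\forall p\in\mathbb P^k$$ be a symmetric OCAD for $\mathbb P^k$ and $\theta=0$, with $\overline\omega_{\star,0}=\overline\omega_\star(0,\mathbb P^k)$, and let $$(\mathrm{A}_{-1}):\ \ \langle p\rangle_\Omega=2\omega_1^{\mathtt{GL}}\langle p\rangle_\Omega^y+\sum_{\ell=2}^{L-1}\sum_{q=1}^Q\omega_\ell^{\mathtt{GL}}\omega_q^{\mathtt G}\,p(\xi_q^{\mathtt G},\xi_\ell^{\mathtt{GL}}),\qquad (\mathrm{A}_{1}):\ \ \langle p\rangle_\Omega=2\omega_1^{\mathtt{GL}}\langle p\rangle_\Omega^x+\sum_{\ell=2}^{L-1}\sum_{q=1}^Q\omega_\ell^{\mathtt{GL}}\omega_q^{\mathtt G}\,p(\xi_\ell^{\mathtt{GL}},\xi_q^{\mathtt G})$$ be the OCADs for $\mathbb P^k$ and $\theta=-1$, $\theta=1$, respectively. Put $$\tau=\frac{\overline\omega_{\star,0}|\theta|}{\overline\omega_{\star,0}|\theta|+\omega_1^{\mathtt{GL}}(1-|\theta|)},\qquad \overline\omega_\star^{\mathtt Q}=\frac{\overline\omega_{\star,0}\,\omega_1^{\mathtt{GL}}}{\overline\omega_{\star,0}|\theta|+\omega_1^{\mathtt{GL}}(1-|\theta|)}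 .$$ Then the symmetric CAD obtained as the convex combination $\tau\cdot(\mathrm A_{-1})+(1-\tau)\cdot(\mathrm A_0)$ if $\theta\in[-1,0]$, and $\tau\cdot(\mathrm A_{1})+(1-\tau)\cdot(\mathrm A_0)$ if $\theta\in[0,1]$, is feasible for $\mathbb P^k$, and it can be equivalently written as $$\langle p\rangle_\Omega=\overline\omega_\star^{\mathtt Q}\big[(1+\theta)\langle p\rangle_\Omega^x+(1-\theta)\langle p\rangle_\Omega^y\big]+\tau\sum_{\ell=2}^{L-1}\sum_{q=1}^Q\omega_\ell^{\mathtt{GL}}\omega_q^{\mathtt G}\,p(x_{\ell q}^{\mathtt Q},y_{\ell q}^{\mathtt Q})+(1-\tau)\sum_{s=1}^{S_0}\omega_0^{(s)}\,\overline{p(x_0^{(s)},y_0^{(s)})},$$ where $(x_{\ell q}^{\mathtt Q},y_{\ell q}^{\mathtt Q})=(\xi_q^{\mathtt G},\xi_\ell^{\mathtt{GL}})$ if $\theta\in[-1,0]$ and $(x_{\ell q}^{\mathtt Q},y_{\ell q}^{\mathtt Q})=(\xi_\ell^{\mathtt{GL}},\xi_q^{\mathtt G})$ if $\theta\in[0,1]$.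
   Context: $\mathbb P^k$: real polynomials in $(x,y)$ of total degree at most $k$. $\Omega=[-1,1]^2$, $\langle p\rangle_\Omega=\frac14\iint_\Omega p$, $\langle p\rangle_\Omega^x=\frac14\int_{-1}^1[p(-1,y)+p(1,y)]dy$, $\langle p\rangle_\Omega^y=\frac14\int_{-1}^1[p(x,-1)+p(x,1)]dx$, $\overline{p(a,b)}=\frac14[p(a,b)+p(-a,b)+p(a,-b)+p(-a,-b)]$. $\{\xi_\ell^{\mathtt{GL}},\omega_\ell^{\mathtt{GL}}\}_{\ell=1}^L$ are the $L$-point Gauss--Lobatto nodes on $[-1,1]$ (increasing, $\xi_1^{\mathtt{GL}}=-1$, $\xi_L^{\mathtt{GL}}=1$) and weights, $\{\xi_q^{\mathtt G},\omega_q^{\mathtt G}\}_{q=1}^Q$ the $Q$-point Gauss nodes on $[-1,1]$ and weights; both sets of weights are normalized to sum to one, so $\omega_1^{\mathtt{GL}}=\frac1{L(L-1)}$. A feasible symmetric CAD for $(\theta,\mathbb P^k)$ with boundary weight $\overline\omega$ is an identity $\langle p\rangle_\Omega=\overline\omega[(1+\theta)\langle p\rangle_\Omega^x+(1-\theta)\langle p\rangle_\Omega^y]+\sum_{s=1}^S\omega_s\overline{p(x^{(s)},y^{(s)})}$ valid for all $p\in\mathbb P^k$, with $S\ge0$ finite, $\overline\omega>0$, all $\omega_s>0$ (terms with zero weight may be dropped), all $(x^{(s)},y^{(s)})\in[0,1]^2$; sums over node sets symmetric under reflection in both axes with equal weights at reflected nodes are of this form after grouping. $\overline\omega_\star(\theta,\mathbb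 P^k)$ is the maximum of $\overline\omega$ over all such CADs, and a symmetric OCAD is one attaining it. *)

theory Defs
  imports "HOL-Analysis.Analysis" "HOL-Computational_Algebra.Polynomial"
begin

(* Polynomials in (x, y) of total degree at most k, viewed as functions on the plane. *)
definition polys2 :: "nat \<Rightarrow> (real \<Rightarrow> real \<Rightarrow> real) set" where
  "polys2 k = {p. \<exists>c :: nat \<Rightarrow> nat \<Rightarrow> real.
     p = (\<lambda>x y. \<Sum>i\<le>k. \<Sum>j\<le>k - i. c i j * x ^ i * y ^ j)}"

definition cell_avg :: "(real \<Rightarrow> real \<Rightarrow> real) \<Rightarrow> real" where
  "cell_avg p = 1/4 * integral ({-1..1} \<times> {-1..1}) (\<lambda>z. p (fst z) (snd z))"

definition avg_x :: "(real \<Rightarrow> real \<Rightarrow> real) \<Rightarrow> real" where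
  "avg_x p = 1/4 * integral {-1..1} (\<lambda>y. p (-1) y + p 1 y)"

definition avg_y :: "(real \<Rightarrow> real \<Rightarrow> real) \<Rightarrow> real" where
  "avg_y p = 1/4 * integral {-1..1} (\<lambda>x. p x (-1) + p x 1)"

definition refl_avg :: "(real \<Rightarrow> real \<Rightarrow> real) \<Rightarrow> real \<Rightarrow> real \<Rightarrow> real" where
  "refl_avg p a b = 1/4 * (p a b + p (-a) b + p a (-b) + p (-a) (-b))"

(* Rodrigues' formula *)
definition legendre :: "nat \<Rightarrow> real poly" where
  "legendre n = smult (1 / (2 ^ n * fact n)) ((pderiv ^^ n) ([:-1, 0, 1:] ^ n))"

(* Weight of the i-th node (counted from 0) in the interpolatory quadrature rule on [-1,1]:
   the integral of the i-th Lagrange basis polynomial; the factor 1/2 makes the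
   weights sum to one. *)
definition interp_weight :: "real list \<Rightarrow> nat \<Rightarrow> real" where
  "interp_weight xs i =
     1/2 * integral {-1..1} (\<lambda>t. \<Prod>j\<in>{..<length xs} - {i}. (t - xs ! j) / (xs ! i - xs ! j))"

definition gauss_nodes :: "nat \<Rightarrow> real list" where
  "gauss_nodes n = sorted_list_of_set {x. poly (legendre n) x = 0}"

(* Meaningful for n \<ge> 2: the end points and the critical points of the Legendre
   polynomial of degree n - 1. *)
definition lobatto_nodes :: "nat \<Rightarrow> real list" where
  "lobatto_nodes n =
     sorted_list_of_set ({-1, 1} \<union> {x. poly (pderiv (legendre (n - 1))) x = 0})"

(* Nodes and weights of the n-point rules are indexed by 1, ..., n. *)
definition xi_G :: "nat \<Rightarrow> nat \<Rightarrow> real" where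
  "xi_G n q = gauss_nodes n ! (q - 1)"

definition om_G :: "nat \<Rightarrow> nat \<Rightarrow> real" where
  "om_G n q = interp_weight (gauss_nodes n) (q - 1)"

definition xi_GL :: "nat \<Rightarrow> nat \<Rightarrow> real" where
  "xi_GL n l = lobatto_nodes n ! (l - 1)"

definition om_GL :: "nat \<Rightarrow> nat \<Rightarrow> real" where
  "om_GL n l = interp_weight (lobatto_nodes n) (l - 1)"

(* The right-hand side of a cell average decomposition (CAD):
   coef_x * <p>^x + coef_y * <p>^y + internal p, where internal p stands for the
   weighted sum of p over the internal nodes. *)
record cad =
  coef_x :: real
  coef_y :: real
  internal :: "(real \<Rightarrow> real \<Rightarrow> real) \<Rightarrow> real"

definition cad_rhs :: "cad \<Rightarrow> (real \<Rightarrow> real \<Rightarrow> real) \<Rightarrow> real" where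
  "cad_rhs A p = coef_x A * avg_x p + coef_y A * avg_y p + internal A p"

definition conv_comb :: "real \<Rightarrow> cad \<Rightarrow> cad \<Rightarrow> cad" where
  "conv_comb t A B =
     \<lparr> coef_x = t * coef_x A + (1 - t) * coef_x B,
       coef_y = t * coef_y A + (1 - t) * coef_y B,
       internal = (\<lambda>p. t * internal A p + (1 - t) * internal B p) \<rparr>"

definition sym_nodes :: "nat \<Rightarrow> (nat \<Rightarrow> real) \<Rightarrow> (nat \<Rightarrow> real) \<Rightarrow> (nat \<Rightarrow> real) \<Rightarrow> bool" where
  "sym_nodes S w X Y \<longleftrightarrow> (\<forall>s\<in>{1..S}. 0 < w s \<and> X s \<in> {0..1} \<and> Y s \<in> {0..1})"

definition sym_sum :: "nat \<Rightarrow> (nat \<Rightarrow> real) \<Rightarrow> (nat \<Rightarrow> real) \<Rightarrow> (nat \<Rightarrow> real)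
    \<Rightarrow> (real \<Rightarrow> real \<Rightarrow> real) \<Rightarrow> real" where
  "sym_sum S w X Y p = (\<Sum>s = 1..S. w s * refl_avg p (X s) (Y s))"

(* The internal sum only has to be of the symmetric form after grouping reflected nodes
   and dropping zero weights. The grouping equation is an equality of node sums, hence
   it is required for every function p, not just for polynomials of degree at most k. *)
definition feasible_cad :: "real \<Rightarrow> nat \<Rightarrow> real \<Rightarrow> cad \<Rightarrow> bool" where
  "feasible_cad \<theta> k wb A \<longleftrightarrow>
     0 < wb \<and> coef_x A = wb * (1 + \<theta>) \<and> coef_y A = wb * (1 - \<theta>) \<and>
     (\<exists>S w X Y. sym_nodes S w X Y \<and> (\<forall>p. internal A p = sym_sum S w X Y p)) \<and>
     (\<forall>p\<in>polys2 k. cell_avg p = cad_rhs A p)"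

definition omega_star :: "real \<Rightarrow> nat \<Rightarrow> real" where
  "omega_star \<theta> k = (GREATEST wb. \<exists>A. feasible_cad \<theta> k wb A)"

(* The second conjunct says that omega_star really is the maximum: GREATEST is
   unspecified when there is none. *)
definition is_ocad :: "real \<Rightarrow> nat \<Rightarrow> cad \<Rightarrow> bool" where
  "is_ocad \<theta> k A \<longleftrightarrow> feasible_cad \<theta> k (omega_star \<theta> k) A \<and>
     (\<forall>wb B. feasible_cad \<theta> k wb B \<longrightarrow> wb \<le> omega_star \<theta> k)"

end

(* The L-point Gauss-Lobatto rule in y combined with the Q-point Gauss rule in x is exact on P^k
   and has positive weights, so it is a feasible CAD for theta = -1. It is optimal because the
   square of the nodal polynomial of the interior Lobatto nodes, as a function of y, has degree
   at most k, is nonnegative and vanishes at all interior nodes: testing an arbitrary CAD with it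
   bounds the boundary weight by the first Lobatto weight. Swapping the axes gives theta = 1.
   CADs are closed under convex combinations, where both the boundary weight and its product with
   theta combine linearly; tau is the solution of the resulting linear equation.

   For the quadrature rules, Rodrigues' formula yields orthogonality by repeated integration by
   parts and simple real roots by iterated use of Rolle's theorem, since the derivatives of
   (x^2 - 1)^n of order less than n vanish at -1 and 1. *)

theory Submission
  imports Defs
begin

section \<open>Interpolatory quadrature\<close>

definition poly_int :: "real poly \<Rightarrow> real" where
  "poly_int p = integral {-1..1} (poly p)"

definition lagrange_basis :: "real set \<Rightarrow> real \<Rightarrow> real poly" where
  "lagrange_basis A x = (\<Prod>y\<in>A - {x}. smult (1 / (x - y)) [:-y, 1:])"

text \<open>Set-based counterpart of \<open>interp_weight\<close>. Indexing a weight by its node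
  instead of a list position makes reflection of the node set and splitting off the end points plain
  set operations.\<close>

definition node_weight :: "real set \<Rightarrow> real \<Rightarrow> real" where
  "node_weight A x = 1/2 * poly_int (lagrange_basis A x)"

section \<open>Integrals of polynomials over [-1,1]\<close>

lemma poly_integrable: "poly (p :: real poly) integrable_on {a..b}"
  by (intro integrable_continuous_interval continuous_intros)

lemma poly_int_add: "poly_int (p + q) = poly_int p + poly_int q"
  unfolding poly_int_def poly_add[abs_def] by (intro integral_add poly_integrable)

lemma poly_int_smult: "poly_int (smult c p) = c * poly_int p"
  unfolding poly_int_def poly_smult[abs_def] by (rule integral_mult_right)

lemma poly_int_0 [simp]: "poly_int 0 = 0"
  unfolding poly_int_def poly_0[abs_def] by simp

lemma poly_int_sum: "poly_int (\<Sum>x\<in>A. f x) = (\<Sum>x\<in>A. poly_int (f x))"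
  by (induction A rule: infinite_finite_induct) (auto simp: poly_int_add)

lemma poly_int_pderiv: "poly_int (pderiv p) = poly p 1 - poly p (-1)"
  unfolding poly_int_def
  by (intro integral_unique fundamental_theorem_of_calculus)
     (auto simp: has_real_derivative_iff_has_vector_derivative[symmetric]
           intro: DERIV_subset[OF poly_DERIV])

lemma poly_int_by_parts:
  assumes "poly u 1 = 0" "poly u (-1) = 0"
  shows "poly_int (pderiv u * v) = - poly_int (u * pderiv v)"
  using poly_int_pderiv[of "u * v"] assms
  by (simp add: pderiv_mult poly_int_add mult.commute)

lemma poly_int_pos:
  assumes nonneg: "\<And>x. x \<in> {-1..1} \<Longrightarrow> poly p x \<ge> 0" and "p \<noteq> 0"
  shows "poly_int p > 0"
proof -
  have "poly_int p \<ge> 0"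
    unfolding poly_int_def by (intro integral_nonneg poly_integrable nonneg)
  moreover have "poly_int p \<noteq> 0"
  proof
    assume "poly_int p = 0"
    then have "\<forall>x\<in>{-1..1}. poly p x = 0"
      unfolding poly_int_def
      by (subst (asm) integral_eq_0_iff) (auto intro!: continuous_intros nonneg)
    then have "{-1..1} \<subseteq> {x. poly p x = 0}" by auto
    then have "finite {-1..1::real}"
      by (rule finite_subset) (rule poly_roots_finite[OF \<open>p \<noteq> 0\<close>])
    then show False using infinite_Icc[of "-1::real" 1] by simp
  qed
  ultimately show ?thesis by simp
qed

section \<open>Lagrange interpolation and degree of exactness\<close>

lemma poly_lagrange_basis: "poly (lagrange_basis A x) t = (\<Prod>y\<in>A - {x}. (t - y) / (x - y))"
proof -
  have "poly [:-y, 1:] t = t - y" for y by simp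
  then show ?thesis by (simp only: lagrange_basis_def poly_prod poly_smult mult_1_left times_divide_eq_left)
qed

lemma poly_lagrange_basis_node:
  assumes "finite A" "y \<in> A" "x \<in> A"
  shows "poly (lagrange_basis A x) y = (if y = x then 1 else 0)"
  using assms by (auto simp: poly_lagrange_basis intro!: prod.neutral prod_zero)

lemma degree_lagrange_basis:
  assumes "finite A" "x \<in> A"
  shows "degree (lagrange_basis A x) < card A"
proof -
  have "degree (lagrange_basis A x) \<le> (\<Sum>y\<in>A - {x}. 1)"
    unfolding lagrange_basis_def
    by (rule order.trans[OF degree_prod_sum_le]) (use assms in \<open>auto intro!: sum_mono\<close>)
  also have "\<dots> < card A"
    using assms card_Diff1_less[of A x] by simp
  finally show ?thesis .
qed

text \<open>A polynomial of degree less than the number of nodes is its own Lagrange interpolant;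
  integrate the interpolant term by term.\<close>

lemma interpolatory_exact:
  assumes "finite A" "degree p < card A"
  shows "1/2 * poly_int p = (\<Sum>x\<in>A. node_weight A x * poly p x)"
proof -
  let ?q = "\<Sum>x\<in>A. smult (poly p x) (lagrange_basis A x)"
  have "p = ?q"
  proof (rule poly_eqI_degree)
    fix y assume "y \<in> A"
    then show "poly p y = poly ?q y"
      using assms(1) by (simp add: poly_sum poly_lagrange_basis_node if_distrib cong: if_cong)
  next
    show "degree ?q < card A"
      using assms by (intro degree_sum_less) (auto intro: le_less_trans[OF degree_smult_le] degree_lagrange_basis)
  qed (use assms in auto)
  then have "poly_int p = poly_int ?q" by simp
  then show ?thesis
    by (simp add: poly_int_sum poly_int_smult node_weight_def sum_distrib_left mult_ac)
qed

text \<open>Division by the nodal polynomial gives \<open>p = w * q + r\<close>. The product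
  integrates to zero because \<open>degree q < d\<close>, and \<open>p\<close> and \<open>r\<close>
  agree at the nodes, so the interpolatory rule for \<open>r\<close> settles the claim.
  Orthogonality up to \<open>d\<close> thus buys \<open>d\<close> additional degrees of
  exactness.\<close>

lemma quadrature_exact:
  assumes "finite A" "card A = degree w" "\<And>x. x \<in> A \<Longrightarrow> poly w x = 0"
    and orth: "\<And>q. degree q < d \<Longrightarrow> poly_int (w * q) = 0"
    and "degree p < card A + d" and "w \<noteq> 0"
  shows "1/2 * poly_int p = (\<Sum>x\<in>A. node_weight A x * poly p x)"
proof (cases "degree p < card A")
  case True
  then show ?thesis using assms interpolatory_exact by blast
next
  case False
  define q r where "q = p div w" and "r = p mod w"
  have p: "p = w * q + r" by (simp add: q_def r_def)
  have dp: "degree w \<le> degree p" using False assms by simp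
  have "degree q < d"
  proof (cases "q = 0")
    case True
    then show ?thesis using False assms by simp
  next
    case q: False
    have "degree r \<le> degree w"
      unfolding r_def using degree_mod_less[OF \<open>w \<noteq> 0\<close>, of p] by auto
    then have "degree (p - r) \<le> degree p"
      using dp by (intro degree_diff_le) auto
    moreover have "degree (p - r) = degree w + degree q"
      using q \<open>w \<noteq> 0\<close> by (simp add: p degree_mult_eq)
    ultimately show ?thesis using assms by linarith
  qed
  then have pr: "poly_int p = poly_int r"
    using orth by (simp add: p poly_int_add)
  have rp: "poly r x = poly p x" if "x \<in> A" for x
    using that assms by (simp add: p)
  show ?thesis
  \<comment> \<open>For an empty node set the remainder is zero, and its degree 0 is not below
    \<open>card A\<close>.\<close>
  proof (cases "r = 0")
    case True
    with rp have "poly p x = 0" if "x \<in> A" for x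
      using that by (metis poly_0)
    then show ?thesis using True pr by simp
  next
    case False
    then have "degree r < card A"
      using degree_mod_less[OF \<open>w \<noteq> 0\<close>, of p] assms(2) by (simp add: r_def)
    then show ?thesis
      using interpolatory_exact[OF assms(1), of r] pr rp by simp
  qed
qed

section \<open>Sign and symmetry of the weights\<close>

text \<open>A nonnegative \<open>f\<close> that vanishes at all nodes but \<open>x\<close> reduces
  the rule to a single term, whose value is a positive integral.\<close>

lemma weight_pos:
  assumes "finite A" "x \<in> A"
    and exact: "1/2 * poly_int f = (\<Sum>x\<in>A. node_weight A x * poly f x)"
    and nonneg: "\<And>x. x \<in> {-1..1} \<Longrightarrow> poly f x \<ge> 0"
    and zero: "\<And>y. y \<in> A \<Longrightarrow> y \<noteq> x \<Longrightarrow> poly f y = 0"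
    and pos: "poly f x > 0"
  shows "node_weight A x > 0"
proof -
  have "f \<noteq> 0" using pos by auto
  then have "0 < poly_int f" using nonneg by (intro poly_int_pos)
  moreover have "(\<Sum>x\<in>A. node_weight A x * poly f x) = node_weight A x * poly f x"
    using assms(1,2) zero by (subst sum.remove[of _ x]) (auto intro!: sum.neutral)
  ultimately have "0 < node_weight A x * poly f x" using exact by linarith
  then show ?thesis using pos by (simp add: zero_less_mult_iff)
qed

text \<open>The substitution of -t for t turns the Lagrange polynomial of \<open>-x\<close> into
  that of \<open>x\<close>, as the node set is invariant.\<close>

lemma node_weight_uminus:
  assumes "uminus ` A = A"
  shows "node_weight A (-x) = node_weight A x"
proof -
  have "poly (lagrange_basis A (-x)) (-t) = poly (lagrange_basis A x) t" for t
  proof -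
    have im: "A - {-x} = uminus ` (A - {x})"
      using assms by (auto simp: image_iff)
    have e: "(-t - (-y)) / (-x - (-y)) = (t - y) / (x - y)" for y
      by (metis minus_diff_minus minus_divide_divide)
    have "poly (lagrange_basis A (-x)) (-t) = (\<Prod>y\<in>uminus ` (A - {x}). (-t - y) / (-x - y))"
      by (simp add: poly_lagrange_basis im)
    also have "\<dots> = (\<Prod>y\<in>A - {x}. (-t - (-y)) / (-x - (-y)))"
      by (subst prod.reindex) (auto simp: o_def)
    also have "\<dots> = poly (lagrange_basis A x) t"
      unfolding poly_lagrange_basis e ..
    finally show ?thesis .
  qed
  then have "integral {-1..1} (poly (lagrange_basis A (-x)))
      = integral {-1..1} (poly (lagrange_basis A x))"
    using Henstock_Kurzweil_Integration.integral_reflect_real[of 1 "-1" "poly (lagrange_basis A (-x))"] by simp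
  then show ?thesis by (simp add: node_weight_def poly_int_def)
qed

lemma interp_weight_sorted_list_of_set:
  assumes "finite A" "i < card A"
  shows "interp_weight (sorted_list_of_set A) i = node_weight A (sorted_list_of_set A ! i)"
proof -
  let ?xs = "sorted_list_of_set A"
  have bij: "bij_betw ((!) ?xs) ({..<length ?xs} - {i}) (A - {?xs ! i})"
    using assms bij_betw_nth[of ?xs "{..<length ?xs}" A]
    by (intro bij_betw_DiffI) (auto simp: bij_betw_def)
  have "(\<Prod>j\<in>{..<length ?xs} - {i}. (t - ?xs ! j) / (?xs ! i - ?xs ! j))
      = poly (lagrange_basis A (?xs ! i)) t" for t
    unfolding poly_lagrange_basis by (rule prod.reindex_bij_betw[OF bij])
  then show ?thesis
    by (simp add: interp_weight_def node_weight_def poly_int_def)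
qed

section \<open>Orthogonality and roots of Legendre polynomials and their derivatives\<close>

text \<open>Rolle's theorem between neighbouring roots. The induction removes the largest root and
  adds a critical point between the two largest ones; it lies beyond \<open>Max R'\<close>, hence is
  distinct from the critical points already found.\<close>

lemma rolle_roots:
  fixes p :: "real poly"
  assumes "finite R" "card R = Suc m" "\<And>x. x \<in> R \<Longrightarrow> poly p x = 0"
  shows "\<exists>A. finite A \<and> card A = m \<and> A \<subseteq> {Min R<..<Max R} \<and> (\<forall>x\<in>A. poly (pderiv p) x = 0)"
  using assms
proof (induction m arbitrary: R)
  case 0
  show ?case by (intro exI[of _ "{}"]) auto
next
  case (Suc m)
  define b where "b = Max R"
  define R' where "R' = R - {b}"
  have b: "b \<in> R"
    unfolding b_def using Suc.prems by (intro Max_in) auto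
  have R': "finite R'" "card R' = Suc m"
    using Suc.prems(1,2) b by (simp_all add: R'_def card_Diff_singleton)
  then have "R' \<noteq> {}" by (metis card.empty nat.distinct(1))
  note R' = R' this
  obtain A where A: "finite A" "card A = m" "A \<subseteq> {Min R'<..<Max R'}"
      "\<forall>x\<in>A. poly (pderiv p) x = 0"
    using Suc.IH[OF R'(1,2)] Suc.prems(3) by (auto simp: R'_def)
  have "Max R' \<in> R'" using R' by simp
  then have "Max R' \<in> R" "Max R' \<noteq> b" by (auto simp: R'_def)
  then have lt: "Max R' < b"
    using Suc.prems(1) by (simp add: b_def order.not_eq_order_implies_strict)
  obtain z where z: "Max R' < z" "z < b" "poly (pderiv p) z = 0"
    using poly_MVT[OF lt, of p] lt b \<open>Max R' \<in> R\<close> Suc.prems(3) by auto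
  have "Min R \<le> Min R'"
    using Suc.prems(1) R' by (intro Min_antimono) (auto simp: R'_def)
  moreover have "Min R' \<le> Max R'" using R' by simp
  moreover have "z \<notin> A" using A(3) z by auto
  ultimately show ?case
    using A z lt
    by (intro exI[of _ "insert z A"]) (auto simp: b_def[symmetric] subset_iff)
qed

text \<open>By the product rule, each differentiation costs at most one factor
  \<open>p\<close>.\<close>

lemma pderiv_funpow_dvd:
  fixes p :: "real poly"
  assumes "m \<le> n"
  shows "p ^ (n - m) dvd (pderiv ^^ m) (p ^ n)"
  using assms
proof (induction m)
  case (Suc m)
  then obtain v where v: "(pderiv ^^ m) (p ^ n) = p ^ (n - m) * v" by (auto elim: dvdE)
  obtain j where j: "n - m = Suc j" "n - Suc m = j" using Suc.prems by (metis Suc_diff_Suc Suc_le_eq)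
  have "p ^ j dvd pderiv (p ^ Suc j * v)"
    unfolding pderiv_mult pderiv_power_Suc
    by (intro dvd_add dvd_mult2 dvd_mult dvd_smult) (auto)
  then show ?case by (simp add: v j)
qed simp

lemma rodrigues_ends:
  assumes "m < n" "x \<in> {-1, 1}"
  shows "poly ((pderiv ^^ m) ([:-1, 0, 1:] ^ n)) x = (0::real)"
proof -
  have "[:-1, 0, 1:] ^ (n - m) dvd (pderiv ^^ m) ([:-1, 0, 1:: real:] ^ n)"
    using assms by (intro pderiv_funpow_dvd) auto
  moreover have "poly ([:-1, 0, 1:] ^ (n - m)) x = 0"
    using assms by auto
  ultimately show ?thesis by (metis dvd_def mult_zero_left poly_mult)
qed

text \<open>Each integration by parts moves one derivative onto \<open>q\<close>, with boundary
  terms vanishing by \<open>rodrigues_ends\<close>; after more than \<open>degree q\<close> of them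
  nothing is left.\<close>

lemma rodrigues_orthogonal:
  assumes "m \<le> n" "degree q < m"
  shows "poly_int ((pderiv ^^ m) ([:-1, 0, 1:] ^ n) * q) = 0"
  using assms
proof (induction m arbitrary: q)
  case (Suc m)
  have "poly_int ((pderiv ^^ Suc m) ([:-1, 0, 1:] ^ n) * q)
      = - poly_int ((pderiv ^^ m) ([:-1, 0, 1:] ^ n) * pderiv q)"
    using Suc.prems rodrigues_ends[of m n] by (simp add: poly_int_by_parts)
  moreover have "poly_int ((pderiv ^^ m) ([:-1, 0, 1:] ^ n) * pderiv q) = 0"
  \<comment> \<open>Differentiating a constant does not lower its degree, so the induction
    hypothesis cannot be applied when \<open>m = 0\<close>.\<close>
  proof (cases "degree q = 0")
    case True
    then have "pderiv q = 0" by (simp add: pderiv_eq_0_iff)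
    then show ?thesis by simp
  next
    case False
    then show ?thesis using Suc by (simp add: degree_pderiv)
  qed
  ultimately show ?case by simp
qed simp

text \<open>The \<open>m\<close> interior roots together with -1 and 1, where derivatives of order
  below \<open>n\<close> still vanish, are \<open>m + 2\<close> roots; Rolle yields
  \<open>m + 1\<close> interior roots of the next derivative.\<close>

lemma rodrigues_roots:
  assumes "m \<le> n"
  shows "\<exists>A. finite A \<and> card A = m \<and> A \<subseteq> {-1<..<1} \<and>
    (\<forall>x\<in>A. poly ((pderiv ^^ m) ([:-1, 0, 1:] ^ n)) x = (0::real))"
  using assms
proof (induction m)
  case 0
  show ?case by (intro exI[of _ "{}"]) auto
next
  case (Suc m)
  then obtain A where A: "finite A" "card A = m" "A \<subseteq> {-1<..<1}"
    "\<forall>x\<in>A. poly ((pderiv ^^ m) ([:-1, 0, 1:] ^ n)) x = (0::real)" by auto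
  let ?R = "insert (-1) (insert 1 A)"
  have "card ?R = Suc (Suc m)" using A by (auto simp: card_insert_if)
  moreover have "Min ?R = -1"
    by (rule Min_eqI) (use A in \<open>auto simp: subset_iff intro: less_imp_le\<close>)
  moreover have "Max ?R = 1"
    by (rule Max_eqI) (use A in \<open>auto simp: subset_iff intro: less_imp_le\<close>)
  ultimately show ?case
    using rolle_roots[of ?R "Suc m" "(pderiv ^^ m) ([:-1, 0, 1:] ^ n)"] A
      rodrigues_ends[of m n] Suc.prems by auto
qed

section \<open>Legendre polynomials: degree, orthogonality and roots\<close>

lemma degree_pderiv_funpow: "degree ((pderiv ^^ m) p) = degree p - m" for p :: "real poly"
  by (induction m) (auto simp: degree_pderiv)

lemma degree_legendre: "degree (legendre n) = n"
  by (simp add: legendre_def degree_pderiv_funpow degree_power_eq)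

lemma legendre_nonzero: "legendre n \<noteq> 0"
proof
  assume "legendre n = 0"
  moreover have "n = 0"
    using \<open>legendre n = 0\<close> degree_legendre[of n] by simp
  ultimately show False by (simp add: legendre_def)
qed

lemma legendre_orthogonal: "degree q < n \<Longrightarrow> poly_int (legendre n * q) = 0"
  unfolding legendre_def mult_smult_left poly_int_smult by (subst rodrigues_orthogonal) auto

text \<open>A nonzero polynomial has at most as many roots as its degree, so a set of that many
  roots is exhaustive. This upgrades the roots supplied by Rolle to the full root sets.\<close>

lemma roots_eq_of_card:
  fixes p :: "real poly"
  assumes "p \<noteq> 0" "A \<subseteq> {x. poly p x = 0}" "card A = degree p"
  shows "{x. poly p x = 0} = A"
  using assms card_poly_roots_bound[OF assms(1)] poly_roots_finite[OF assms(1)]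
  by (metis card_seteq)

lemma legendre_roots:
  fixes n defines "G \<equiv> {x. poly (legendre n) x = 0}"
  shows "finite G" "card G = n" "G \<subseteq> {-1<..<1}"
proof -
  obtain A where A: "finite A" "card A = n" "A \<subseteq> {-1<..<1}"
    "\<forall>x\<in>A. poly ((pderiv ^^ n) ([:-1, 0, 1:] ^ n)) x = (0::real)"
    using rodrigues_roots[of n n] by auto
  have "G = A"
    unfolding G_def using A
    by (intro roots_eq_of_card) (auto simp: legendre_nonzero degree_legendre, auto simp: legendre_def)
  then show "finite G" "card G = n" "G \<subseteq> {-1<..<1}" using A by auto
qed

lemma pderiv_legendre_nonzero: "n \<ge> 1 \<Longrightarrow> pderiv (legendre n) \<noteq> 0"
  by (simp add: pderiv_eq_0_iff degree_legendre)

lemma pderiv_legendre_roots: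
  fixes n assumes "n \<ge> 1"
  defines "I \<equiv> {x. poly (pderiv (legendre n)) x = 0}"
  shows "finite I" "card I = n - 1" "I \<subseteq> {-1<..<1}"
proof -
  let ?G = "{x. poly (legendre n) x = 0}"
  note G = legendre_roots[of n]
  have "?G \<noteq> {}"
  proof
    assume "?G = {}"
    with G(2) show False using assms by (metis card.empty not_one_le_zero)
  qed
  then have "Min ?G \<in> ?G" "Max ?G \<in> ?G" using G by (metis Min_in, metis Max_in)
  then have "-1 \<le> Min ?G" "Max ?G \<le> 1" using G(3) by fastforce+
  then have sub: "{Min ?G<..<Max ?G} \<subseteq> {-1<..<1}"
    by (simp add: greaterThanLessThan_subseteq_greaterThanLessThan)
  have "card ?G = Suc (n - 1)" using G(2) assms(1) by linarith
  then obtain A where A: "finite A" "card A = n - 1" "A \<subseteq> {Min ?G<..<Max ?G}"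
      "\<forall>x\<in>A. poly (pderiv (legendre n)) x = 0"
    using rolle_roots[OF G(1), of "n - 1" "legendre n"] by blast
  have "I = A"
    unfolding I_def using A assms
    by (intro roots_eq_of_card) (auto simp: pderiv_legendre_nonzero degree_legendre degree_pderiv)
  show "finite I" unfolding \<open>I = A\<close> by (rule A(1))
  show "card I = n - 1" unfolding \<open>I = A\<close> by (rule A(2))
  show "I \<subseteq> {-1<..<1}" unfolding \<open>I = A\<close> by (rule subset_trans[OF A(3) sub])
qed

text \<open>The factor x^2 - 1 kills the boundary terms when the derivative is moved off the
  Legendre polynomial. It lands on (x^2 - 1) q, whose derivative has degree at most
  \<open>degree q + 1 < n\<close>, so Legendre orthogonality applies.\<close>

lemma pderiv_legendre_orthogonal:
  assumes "degree q < n - 1"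
  shows "poly_int ([:-1, 0, 1:] * pderiv (legendre n) * q) = 0"
proof -
  have "degree (pderiv ([:-1, 0, 1:] * q)) < n"
    using assms degree_mult_le[of "[:-1, 0, 1:]" q] by (auto simp: degree_pderiv)
  then have "poly_int (legendre n * pderiv ([:-1, 0, 1:] * q)) = 0"
    by (rule legendre_orthogonal)
  moreover have "poly_int (pderiv ([:-1, 0, 1:] * q) * legendre n)
      = - poly_int ([:-1, 0, 1:] * q * pderiv (legendre n))"
    by (rule poly_int_by_parts) auto
  moreover have "[:-1, 0, 1:] * pderiv (legendre n) * q = [:-1, 0, 1:] * q * pderiv (legendre n)"
    "pderiv ([:-1, 0, 1:] * q) * legendre n = legendre n * pderiv ([:-1, 0, 1:] * q)"
    by (simp_all only: mult_ac)
  ultimately show ?thesis by (metis neg_equal_0_iff_equal)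
qed

section \<open>Symmetry of the root sets\<close>

text \<open>The factor \<open>s\<close> is left arbitrary instead of being fixed as 1 or -1: any
  nonzero factor makes the root set symmetric, and differentiation merely replaces \<open>s\<close>
  by \<open>- s\<close>.\<close>

definition has_parity :: "real poly \<Rightarrow> bool" where
  "has_parity p \<longleftrightarrow> (\<exists>s. s \<noteq> 0 \<and> pcompose p [:0, -1:] = smult s p)"

lemma has_parity_pderiv: "has_parity p \<Longrightarrow> has_parity (pderiv p)"
proof -
  assume "has_parity p"
  then obtain s where s: "s \<noteq> 0" "pcompose p [:0, -1:] = smult s p" by (auto simp: has_parity_def)
  have "pderiv (pcompose p [:0, -1:]) = smult s (pderiv p)"
    by (simp add: s pderiv_smult)
  then have "- pcompose (pderiv p) [:0, -1:] = smult s (pderiv p)"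
    by (simp add: pderiv_pcompose pderiv_pCons)
  then have "pcompose (pderiv p) [:0, -1:] = smult (- s) (pderiv p)"
    by (metis minus_equation_iff smult_minus_left)
  with s show ?thesis unfolding has_parity_def by (intro exI[of _ "- s"]) auto
qed

lemma has_parity_legendre: "has_parity (legendre n)"
proof -
  have "pcompose ([:-1, 0, 1:] ^ n) [:0, -1:] = ([:-1, 0, 1:] :: real poly) ^ n"
    by (induction n) (simp_all only: power_0 power_Suc pcompose_1 pcompose_mult, simp add: pcompose_pCons)
  then have "has_parity ([:-1, 0, 1:] ^ n)"
    unfolding has_parity_def by (intro exI[of _ 1]) auto
  then have "has_parity ((pderiv ^^ m) ([:-1, 0, 1:] ^ n))" for m
    by (induction m) (auto intro: has_parity_pderiv)
  from this[of n] show ?thesis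
    by (auto simp: has_parity_def legendre_def pcompose_smult)
qed

lemma has_parity_roots:
  assumes "has_parity p"
  shows "uminus ` {x. poly p x = 0} = {x. poly p x = 0}"
proof -
  obtain s where s: "s \<noteq> 0" "pcompose p [:0, -1:] = smult s p"
    using assms by (auto simp: has_parity_def)
  have "poly (pcompose p [:0, -1:]) x = s * poly p x" for x by (simp add: s)
  then have "poly p (-x) = s * poly p x" for x by (simp add: poly_pcompose)
  then show ?thesis using s(1) by (auto simp: image_iff) (metis minus_minus mult_eq_0_iff)
qed

section \<open>Gauss and Gauss--Lobatto quadrature\<close>

definition gauss_set :: "nat \<Rightarrow> real set" where
  "gauss_set n = {x. poly (legendre n) x = 0}"

definition lobatto_interior :: "nat \<Rightarrow> real set" where
  "lobatto_interior n = {x. poly (pderiv (legendre (n - 1))) x = 0}"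

definition lobatto_set :: "nat \<Rightarrow> real set" where
  "lobatto_set n = {-1, 1} \<union> lobatto_interior n"

lemma gauss_nodes_eq: "gauss_nodes n = sorted_list_of_set (gauss_set n)"
  unfolding gauss_nodes_def gauss_set_def ..

lemma lobatto_nodes_eq_sorted_set: "lobatto_nodes n = sorted_list_of_set (lobatto_set n)"
  unfolding lobatto_nodes_def lobatto_set_def lobatto_interior_def ..

lemma legendre_gauss_set: "x \<in> gauss_set n \<Longrightarrow> poly (legendre n) x = 0"
  by (simp add: gauss_set_def)

lemma lobatto_set_root:
  "x \<in> lobatto_set n \<Longrightarrow> poly ([:-1, 0, 1:] * pderiv (legendre (n - 1))) x = 0"
  by (auto simp: lobatto_set_def lobatto_interior_def)

lemma gauss_set_props:
  "finite (gauss_set n)" "card (gauss_set n) = n" "gauss_set n \<subseteq> {-1<..<1}"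
  "uminus ` gauss_set n = gauss_set n"
  unfolding gauss_set_def
  by (intro legendre_roots has_parity_roots has_parity_legendre)+

lemma lobatto_interior_props:
  assumes "n \<ge> 2"
  shows "finite (lobatto_interior n)" "card (lobatto_interior n) = n - 2"
    "lobatto_interior n \<subseteq> {-1<..<1}" "uminus ` lobatto_interior n = lobatto_interior n"
  using pderiv_legendre_roots[of "n - 1"] assms
    has_parity_roots[OF has_parity_pderiv[OF has_parity_legendre[of "n - 1"]]]
  unfolding lobatto_interior_def by (auto simp: numeral_2_eq_2)

lemma lobatto_set_props:
  assumes "n \<ge> 2"
  shows "finite (lobatto_set n)" "card (lobatto_set n) = n" "uminus ` lobatto_set n = lobatto_set n"
proof -
  note I = lobatto_interior_props[OF assms]
  have "1 \<notin> lobatto_interior n" "-1 \<notin> lobatto_interior n" using I(3) by auto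
  then show "finite (lobatto_set n)" "card (lobatto_set n) = n"
    using I(1,2) assms by (simp_all add: lobatto_set_def)
  show "uminus ` lobatto_set n = lobatto_set n"
    using I(4) by (simp add: lobatto_set_def image_Un insert_commute)
qed

lemma gauss_exact:
  assumes "degree p < 2 * n"
  shows "1/2 * poly_int p = (\<Sum>x\<in>gauss_set n. node_weight (gauss_set n) x * poly p x)"
  using assms
  by (intro quadrature_exact[where w = "legendre n" and d = n])
     (auto simp: gauss_set_props degree_legendre legendre_nonzero legendre_orthogonal legendre_gauss_set)

text \<open>The nodal polynomial (x^2 - 1) P' with P the Legendre polynomial of degree n - 1 has
  degree n and is orthogonal to all degrees below n - 2, which gives exactness up to n + (n - 2) - 1
  = 2n - 3.\<close>

lemma lobatto_exact:
  assumes "n \<ge> 2" "degree p \<le> 2 * n - 3"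
  shows "1/2 * poly_int p = (\<Sum>x\<in>lobatto_set n. node_weight (lobatto_set n) x * poly p x)"
proof (rule quadrature_exact[where w = "[:-1, 0, 1:] * pderiv (legendre (n - 1))" and d = "n - 2"])
  have nz: "pderiv (legendre (n - 1)) \<noteq> 0"
    using assms by (intro pderiv_legendre_nonzero) auto
  show "[:-1, 0, 1:] * pderiv (legendre (n - 1)) \<noteq> 0"
    unfolding mult_eq_0_iff using nz by simp
  have "degree ([:-1, 0, 1:] * pderiv (legendre (n - 1))) = 2 + (n - 2)"
    using nz by (subst degree_mult_eq) (auto simp: degree_pderiv degree_legendre numeral_2_eq_2)
  then show "card (lobatto_set n) = degree ([:-1, 0, 1:] * pderiv (legendre (n - 1)))"
    using assms by (simp add: lobatto_set_props del: mult_pCons_left)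
  show "poly_int ([:-1, 0, 1:] * pderiv (legendre (n - 1)) * q) = 0" if "degree q < n - 2" for q
    using that by (intro pderiv_legendre_orthogonal) auto
  show "degree p < card (lobatto_set n) + (n - 2)"
    using assms by (simp add: lobatto_set_props)
  show "finite (lobatto_set n)" using assms by (simp add: lobatto_set_props)
qed (rule lobatto_set_root)

section \<open>Positivity of the weights\<close>

text \<open>The basic nonnegative test polynomial: for finite \<open>A\<close> it vanishes exactly
  on \<open>A\<close>. It serves both the positivity of the weights and the optimality
  bound.\<close>

definition node_square :: "real set \<Rightarrow> real poly" where
  "node_square A = (\<Prod>y\<in>A. [:-y, 1:])\<^sup>2"

lemma poly_node_square: "finite A \<Longrightarrow> poly (node_square A) x = 0 \<longleftrightarrow> x \<in> A"
  by (auto simp: node_square_def poly_prod)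

lemma poly_node_square_nonneg: "poly (node_square A) x \<ge> 0"
  by (simp add: node_square_def)

lemma poly_node_square_pos: "finite A \<Longrightarrow> x \<notin> A \<Longrightarrow> poly (node_square A) x > 0"
  using poly_node_square[of A x] poly_node_square_nonneg[of A x] by linarith

lemma degree_node_square: "degree (node_square A) \<le> 2 * card A"
proof -
  have "degree (\<Prod>y\<in>A. [:-y, 1:]) \<le> card A"
    by (cases "finite A") (use degree_prod_sum_le[of A "\<lambda>y. [:-y, 1:]"] in auto)
  then show ?thesis
    unfolding node_square_def using degree_power_le[of "\<Prod>y\<in>A. [:-y, 1:]" 2] by linarith
qed

text \<open>Squaring the nodal polynomial of the other n - 1 nodes gives degree at most 2n - 2,
  within the exactness of the rule.\<close>

lemma gauss_weight_pos:
  assumes "x \<in> gauss_set n"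
  shows "node_weight (gauss_set n) x > 0"
proof -
  note G = gauss_set_props[of n]
  let ?f = "node_square (gauss_set n - {x})"
  have "n > 0" using G(1,2) assms by (metis card_gt_0_iff empty_iff)
  then have "degree ?f < 2 * n"
    using degree_node_square[of "gauss_set n - {x}"] G(1,2) assms by simp
  then show ?thesis
    by (intro weight_pos[OF G(1) assms gauss_exact[where p = ?f]])
       (use G(1) in \<open>auto simp: poly_node_square poly_node_square_nonneg poly_node_square_pos\<close>)
qed

lemma lobatto_weight_pos:
  assumes "n \<ge> 2" "x \<in> lobatto_set n"
  shows "node_weight (lobatto_set n) x > 0"
proof -
  note I = lobatto_interior_props[OF assms(1)] and A = lobatto_set_props[OF assms(1)]
  define J where "J = lobatto_interior n - {x}"
  \<comment> \<open>The test polynomial is \<open>node_square J\<close> times the factor of least degree that is nonnegative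
    on [-1,1] and vanishes at the end points other than x: squaring the end point factors
    as well would exceed the degree of exactness.\<close>
  define e where "e = (if x = -1 then [:1, -1:] else if x = 1 then [:1, 1:] else [:1, 0, -1::real:])"
  define f where "f = e * node_square J"
  have fin: "finite J" using I by (simp add: J_def)
  have xJ: "x \<notin> J" by (simp add: J_def)
  have e_nonneg: "poly e t \<ge> 0" if "t \<in> {-1..1}" for t
  proof -
    have "t * t \<le> 1" using that by (simp add: abs_le_iff abs_square_le_1 flip: power2_eq_square)
    with that show ?thesis by (auto simp: e_def)
  qed
  have x: "x = -1 \<or> x = 1 \<or> x \<in> {-1<..<1} \<and> x \<in> lobatto_interior n"
    using assms(2) I(3) by (auto simp: lobatto_set_def)
  have e_pos: "poly e x > 0"
  proof -
    have "x * x < 1" if "x \<in> {-1<..<1}"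
      using that by (simp add: abs_square_less_1 abs_less_iff flip: power2_eq_square)
    with x show ?thesis by (auto simp: e_def)
  qed
  have "degree f \<le> degree e + degree (node_square J)"
    unfolding f_def by (rule degree_mult_le)
  \<comment> \<open>An interior node gives at most 2 + 2(n - 3) = 2n - 4, an end point at most 1 +
    2(n - 2) = 2n - 3.\<close>
  also have "\<dots> \<le> 2 * n - 3"
  proof (cases "x \<in> lobatto_interior n")
    case True
    then have "n - 2 > 0" using I(1,2) by (metis card_gt_0_iff empty_iff)
    moreover have "card J = n - 2 - 1" using True I by (simp add: J_def)
    moreover have "degree e \<le> 2" by (simp add: e_def)
    ultimately show ?thesis using degree_node_square[of J] by linarith
  next
    case False
    then have "degree e = 1" using x by (auto simp: e_def)
    moreover have "card J = n - 2" using False I by (simp add: J_def)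
    ultimately show ?thesis using degree_node_square[of J] assms(1) by linarith
  qed
  finally have "degree f \<le> 2 * n - 3" .
  then show ?thesis
  proof (intro weight_pos[where f = f] lobatto_exact A assms)
    show "poly f t \<ge> 0" if "t \<in> {-1..1}" for t
      using e_nonneg[OF that] by (simp add: f_def poly_node_square_nonneg)
    show "poly f x > 0"
      using e_pos fin xJ by (simp add: f_def poly_node_square_pos)
    show "poly f y = 0" if "y \<in> lobatto_set n" "y \<noteq> x" for y
      using that fin by (auto simp: f_def lobatto_set_def J_def e_def poly_node_square)
  qed
qed

section \<open>From indexed nodes and weights to node sets\<close>

lemma xi_G_bij: "bij_betw (xi_G n) {1..n} (gauss_set n)"
proof -
  have "bij_betw ((!) (gauss_nodes n)) {..<n} (gauss_set n)"
    by (rule bij_betw_nth) (auto simp: gauss_nodes_eq gauss_set_props)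
  moreover have "bij_betw (\<lambda>q. q - 1) {1..n} {..<n}"
    by (rule bij_betwI[where g = Suc]) auto
  ultimately show ?thesis
    using bij_betw_trans by (auto simp: xi_G_def[abs_def] o_def)
qed

lemma om_G_eq: "q \<in> {1..n} \<Longrightarrow> om_G n q = node_weight (gauss_set n) (xi_G n q)"
  using interp_weight_sorted_list_of_set[of "gauss_set n" "q - 1"]
  by (auto simp: om_G_def xi_G_def gauss_nodes_eq gauss_set_props)

lemma lobatto_nodes_eq:
  assumes "n \<ge> 2"
  shows "lobatto_nodes n = -1 # sorted_list_of_set (lobatto_interior n) @ [1]"
proof -
  note I = lobatto_interior_props[OF assms]
  let ?xs = "-1 # sorted_list_of_set (lobatto_interior n) @ [1::real]"
  have "sorted ?xs" "distinct ?xs"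
    using I(1,3) by (auto simp: sorted_append less_imp_le subset_iff)
  moreover have "set ?xs = lobatto_set n"
    using I(1) by (auto simp: lobatto_set_def)
  ultimately have "sorted_list_of_set (lobatto_set n) = ?xs"
    by (metis sorted_list_of_set.idem_if_sorted_distinct)
  then show ?thesis
    by (simp add: lobatto_nodes_eq_sorted_set)
qed

lemma xi_GL_first: "n \<ge> 2 \<Longrightarrow> xi_GL n 1 = -1"
  by (simp add: xi_GL_def lobatto_nodes_eq)

lemma xi_GL_bij:
  assumes "n \<ge> 2"
  shows "bij_betw (xi_GL n) {2..n - 1} (lobatto_interior n)"
proof -
  note I = lobatto_interior_props[OF assms]
  let ?xs = "sorted_list_of_set (lobatto_interior n)"
  have "bij_betw ((!) ?xs) {..<n - 2} (lobatto_interior n)"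
    by (rule bij_betw_nth) (auto simp: I)
  moreover have "bij_betw (\<lambda>l. l - 2) {2..n - 1} {..<n - 2}"
    by (rule bij_betwI[where g = "\<lambda>l. l + 2"]) auto
  ultimately have "bij_betw (\<lambda>l. ?xs ! (l - 2)) {2..n - 1} (lobatto_interior n)"
    using bij_betw_trans by (auto simp: o_def)
  moreover have "xi_GL n l = ?xs ! (l - 2)" if "l \<in> {2..n - 1}" for l
  proof -
    \<comment> \<open>Position \<open>l - 1\<close> of the full list is position
      \<open>l - 2\<close> of the interior list, because -1 comes first; the length bound keeps it
      before the final 1.\<close>
    have "l - 1 = Suc (l - 2)" "l - 2 < length ?xs" using that I by auto
    then show ?thesis by (simp add: xi_GL_def lobatto_nodes_eq[OF assms] nth_append)
  qed
  ultimately show ?thesis by (subst bij_betw_cong) auto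
qed

lemma om_GL_eq:
  assumes "n \<ge> 2" "l \<in> {1..n}"
  shows "om_GL n l = node_weight (lobatto_set n) (xi_GL n l)"
  using interp_weight_sorted_list_of_set[of "lobatto_set n" "l - 1"] assms
  by (auto simp: om_GL_def xi_GL_def lobatto_nodes_eq_sorted_set lobatto_set_props)

text \<open>Reflection symmetry gives both end points the same weight, so a single number describes
  the boundary part of the rule.\<close>

lemma om_GL_first:
  assumes "n \<ge> 2"
  shows "om_GL n 1 = node_weight (lobatto_set n) (-1)" "om_GL n 1 = node_weight (lobatto_set n) 1"
    "om_GL n 1 > 0"
proof -
  show *: "om_GL n 1 = node_weight (lobatto_set n) (-1)"
    using assms om_GL_eq[of n 1] xi_GL_first[of n] by simp
  then show "om_GL n 1 = node_weight (lobatto_set n) 1"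
    by (simp add: node_weight_uminus lobatto_set_props assms)
  show "om_GL n 1 > 0"
    unfolding * using assms by (intro lobatto_weight_pos) (auto simp: lobatto_set_def)
qed

lemma lobatto_exact_split:
  assumes "n \<ge> 2" "degree p \<le> 2 * n - 3"
  shows "1/2 * poly_int p = om_GL n 1 * (poly p (-1) + poly p 1)
    + (\<Sum>y\<in>lobatto_interior n. node_weight (lobatto_set n) y * poly p y)"
proof -
  note I = lobatto_interior_props[OF assms(1)]
  have "1 \<notin> lobatto_interior n" "-1 \<notin> lobatto_interior n" using I(3) by auto
  then have "(\<Sum>x\<in>lobatto_set n. F x) = F (-1) + F 1 + sum F (lobatto_interior n)"
    for F :: "real \<Rightarrow> real"
    using I(1) by (simp add: lobatto_set_def)
  then show ?thesis
    unfolding lobatto_exact[OF assms] using om_GL_first[OF assms(1)]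
    by (simp add: algebra_simps)
qed

lemma lobatto_gauss_sum_eq:
  assumes "n \<ge> 2"
  shows "(\<Sum>l = 2..n - 1. \<Sum>q = 1..m. om_GL n l * om_G m q * p (xi_G m q) (xi_GL n l))
    = (\<Sum>y\<in>lobatto_interior n. \<Sum>x\<in>gauss_set m.
         node_weight (lobatto_set n) y * node_weight (gauss_set m) x * p x y)"
proof -
  have "(\<Sum>l = 2..n - 1. \<Sum>q = 1..m. om_GL n l * om_G m q * p (xi_G m q) (xi_GL n l))
    = (\<Sum>l = 2..n - 1. \<Sum>q = 1..m. node_weight (lobatto_set n) (xi_GL n l) *
         node_weight (gauss_set m) (xi_G m q) * p (xi_G m q) (xi_GL n l))"
    using assms by (intro sum.cong) (auto simp: om_GL_eq om_G_eq)
  also have "\<dots> = (\<Sum>l = 2..n - 1. \<Sum>x\<in>gauss_set m. node_weight (lobatto_set n) (xi_GL n l) *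
         node_weight (gauss_set m) x * p x (xi_GL n l))"
    by (intro sum.cong refl sum.reindex_bij_betw[OF xi_G_bij])
  also have "\<dots> = (\<Sum>y\<in>lobatto_interior n. \<Sum>x\<in>gauss_set m.
         node_weight (lobatto_set n) y * node_weight (gauss_set m) x * p x y)"
    by (rule sum.reindex_bij_betw[OF xi_GL_bij[OF assms]])
  finally show ?thesis .
qed

section \<open>Cell average decompositions\<close>

text \<open>The existential clause of \<open>feasible_cad\<close>, isolated as a property of the
  functional so that closure properties can be stated without carrying nodes along.\<close>

definition is_sym_sum :: "((real \<Rightarrow> real \<Rightarrow> real) \<Rightarrow> real) \<Rightarrow> bool" where
  "is_sym_sum F \<longleftrightarrow> (\<exists>S w X Y. sym_nodes S w X Y \<and> (\<forall>p. F p = sym_sum S w X Y p))"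

text \<open>Terms of weight zero are dropped and the remaining indices are renumbered by a
  bijection. Allowing any finite index set and zero weights is what convex combinations with
  \<open>t = 0\<close> or \<open>t = 1\<close> and product rules call for.\<close>

lemma is_sym_sumI:
  assumes "finite K"
    and K: "\<And>i. i \<in> K \<Longrightarrow> w i \<ge> 0 \<and> X i \<in> {0..1} \<and> Y i \<in> {0..1}"
    and F: "\<And>p. F p = (\<Sum>i\<in>K. w i * refl_avg p (X i) (Y i))"
  shows "is_sym_sum F"
proof -
  let ?K = "{i \<in> K. w i > 0}"
  obtain h where h: "bij_betw h {1..card ?K} ?K"
    using ex_bij_betw_nat_finite_1[of ?K] assms(1) by auto
  have "F p = sym_sum (card ?K) (w \<circ> h) (X \<circ> h) (Y \<circ> h) p" for p
  proof -
    have "F p = (\<Sum>i\<in>?K. w i * refl_avg p (X i) (Y i))"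
      unfolding F using assms(1) K by (intro sum.mono_neutral_right) (auto simp: order.order_iff_strict)
    also have "\<dots> = sym_sum (card ?K) (w \<circ> h) (X \<circ> h) (Y \<circ> h) p"
      unfolding sym_sum_def by (subst sum.reindex_bij_betw[OF h, symmetric]) simp
    finally show ?thesis .
  qed
  moreover have "sym_nodes (card ?K) (w \<circ> h) (X \<circ> h) (Y \<circ> h)"
    unfolding sym_nodes_def
  proof
    fix s assume "s \<in> {1..card ?K}"
    then have "h s \<in> ?K" using h by (rule bij_betw_apply[rotated])
    then show "0 < (w \<circ> h) s \<and> (X \<circ> h) s \<in> {0..1} \<and> (Y \<circ> h) s \<in> {0..1}"
      using K[of "h s"] by simp
  qed
  ultimately show ?thesis unfolding is_sym_sum_def by blast
qed

text \<open>The two node families are joined over the disjoint union of their index sets, with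
  weights scaled by \<open>t\<close> and \<open>1 - t\<close>.\<close>

lemma is_sym_sum_convex:
  assumes "is_sym_sum F" "is_sym_sum G" "t \<in> {0..1}"
  shows "is_sym_sum (\<lambda>p. t * F p + (1 - t) * G p)"
proof -
  obtain S w X Y where F: "sym_nodes S w X Y" "\<And>p. F p = sym_sum S w X Y p"
    using assms(1) by (auto simp: is_sym_sum_def)
  obtain S' w' X' Y' where G: "sym_nodes S' w' X' Y'" "\<And>p. G p = sym_sum S' w' X' Y' p"
    using assms(2) by (auto simp: is_sym_sum_def)
  show ?thesis
  proof (rule is_sym_sumI)
    show "finite ({1..S} <+> {1..S'})" by simp
    show "t * F p + (1 - t) * G p = (\<Sum>i\<in>{1..S} <+> {1..S'}.
        case_sum (\<lambda>s. t * w s) (\<lambda>s. (1 - t) * w' s) i * refl_avg p (case_sum X X' i) (case_sum Y Y' i))" for p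
      by (simp add: F G sym_sum_def sum.Plus o_def sum_distrib_left mult.assoc)
    show "case_sum (\<lambda>s. t * w s) (\<lambda>s. (1 - t) * w' s) i \<ge> 0 \<and> case_sum X X' i \<in> {0..1} \<and>
        case_sum Y Y' i \<in> {0..1}" if "i \<in> {1..S} <+> {1..S'}" for i
      using that F(1) G(1) assms(3) by (auto simp: sym_nodes_def less_imp_le)
  qed
qed

text \<open>The weighted sum is unchanged by reflecting the integrand in either axis, hence equals
  the mean of its four reflected versions. Since \<open>refl_avg\<close> is even in both arguments,
  absolute values may be inserted; they move the nodes of a rule on the square into [0,1]^2.\<close>

lemma sum_product_refl_avg:
  assumes "uminus ` A = A" "uminus ` B = B"
    and "\<And>x. w (-x) = w x" "\<And>y. v (-y) = v y"
  shows "(\<Sum>y\<in>B. \<Sum>x\<in>A. v y * w x * p x y) = (\<Sum>y\<in>B. \<Sum>x\<in>A. v y * w x * refl_avg p \<bar>x\<bar> \<bar>y\<bar>)"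
proof -
  have reflect: "(\<Sum>x\<in>C. f (-x)) = (\<Sum>x\<in>C. f x)" if "uminus ` C = C" for C and f :: "real \<Rightarrow> real"
    using sum.reindex[of uminus C f] that by (simp add: o_def)
  define T where "T f = (\<Sum>y\<in>B. \<Sum>x\<in>A. v y * w x * f x y)" for f
  have x: "T (\<lambda>x y. f (-x) y) = T f" for f
    unfolding T_def using reflect[OF assms(1), of "\<lambda>x. v y * w x * f x y" for y] by (simp add: assms(3))
  have y: "T (\<lambda>x y. f x (-y)) = T f" for f
    unfolding T_def using reflect[OF assms(2), of "\<lambda>y. \<Sum>x\<in>A. v y * w x * f x y"] by (simp add: assms(4))
  have "refl_avg p \<bar>x\<bar> \<bar>y\<bar> = refl_avg p x y" for x y
    by (cases "x \<ge> 0"; cases "y \<ge> 0") (simp_all add: refl_avg_def)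
  then have "T (\<lambda>x y. refl_avg p \<bar>x\<bar> \<bar>y\<bar>) = T (refl_avg p)" by presburger
  also have "\<dots> = 1/4 * (T p + T (\<lambda>x y. p (-x) y) + T (\<lambda>x y. p x (-y)) + T (\<lambda>x y. p (-x) (-y)))"
    unfolding T_def refl_avg_def
    by (simp add: sum_distrib_left sum.distrib[symmetric] algebra_simps)
  also have "\<dots> = T p"
    using x[of p] y[of p] x[of "\<lambda>x y. p x (-y)"] by simp
  finally show ?thesis by (simp add: T_def)
qed

section \<open>Polynomials in two variables and iterated integrals\<close>

lemma polys2_slice_y:
  assumes "p \<in> polys2 k"
  shows "\<exists>q. degree q \<le> k \<and> p x = poly q"
proof -
  obtain c where p: "p = (\<lambda>x y. \<Sum>i\<le>k. \<Sum>j\<le>k - i. c i j * x ^ i * y ^ j)"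
    using assms by (auto simp: polys2_def)
  let ?q = "\<Sum>i\<le>k. \<Sum>j\<le>k - i. monom (c i j * x ^ i) j"
  have "degree ?q \<le> k"
    by (intro degree_sum_le) (auto intro!: order.trans[OF degree_monom_le])
  moreover have "p x = poly ?q" by (auto simp: p poly_sum poly_monom)
  ultimately show ?thesis by blast
qed

lemma polys2_swap:
  assumes "p \<in> polys2 k"
  shows "(\<lambda>x y. p y x) \<in> polys2 k"
proof -
  obtain c where p: "p = (\<lambda>x y. \<Sum>i\<le>k. \<Sum>j\<le>k - i. c i j * x ^ i * y ^ j)"
    using assms by (auto simp: polys2_def)
  have swap: "(\<Sum>i\<le>k. \<Sum>j\<le>k - i. f i j) = (\<Sum>j\<le>k. \<Sum>i\<le>k - j. f i j)" for f :: "nat \<Rightarrow> nat \<Rightarrow> real"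
    unfolding sum.Sigma[OF finite_atMost ballI[OF finite_atMost]]
    by (rule sum.reindex_bij_witness[of _ "\<lambda>(i, j). (j, i)" "\<lambda>(i, j). (j, i)"]) auto
  have "(\<lambda>x y. p y x) = (\<lambda>x y. \<Sum>i\<le>k. \<Sum>j\<le>k - i. c j i * x ^ i * y ^ j)"
    unfolding p by (subst swap) (simp add: mult_ac)
  then show ?thesis by (auto simp: polys2_def)
qed

lemma polys2_slice_x:
  assumes "p \<in> polys2 k"
  shows "\<exists>q. degree q \<le> k \<and> (\<lambda>x. p x y) = poly q"
  using polys2_slice_y[OF polys2_swap[OF assms]] .

lemma polys2_of_poly:
  assumes "degree q \<le> k"
  shows "(\<lambda>x. poly q) \<in> polys2 k"
proof -
  have "poly q y = (\<Sum>i\<le>k. \<Sum>j\<le>k - i. (if i = 0 then coeff q j else 0) * x ^ i * y ^ j)" for x y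
  proof -
    have "(\<Sum>i\<le>k. \<Sum>j\<le>k - i. (if i = 0 then coeff q j else 0) * x ^ i * y ^ j)
        = (\<Sum>i\<le>k. if i = 0 then \<Sum>j\<le>k. coeff q j * y ^ j else 0)"
      by (intro sum.cong) auto
    also have "\<dots> = (\<Sum>j\<le>k. coeff q j * y ^ j)" by simp
    also have "\<dots> = poly q y"
      unfolding poly_altdef using assms
      by (intro sum.mono_neutral_right) (auto simp: coeff_eq_0)
    finally show ?thesis by simp
  qed
  then show ?thesis
    unfolding polys2_def by (intro CollectI exI[of _ "\<lambda>i j. if i = 0 then coeff q j else 0"]) auto
qed

lemma continuous_on_polys2:
  assumes "p \<in> polys2 k"
  shows "continuous_on A (\<lambda>z. p (fst z) (snd z))"
  using assms by (auto simp: polys2_def intro!: continuous_intros)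

lemma polys2_integrable:
  assumes "p \<in> polys2 k"
  shows "(\<lambda>x. p x y) integrable_on {a..b}"
  using polys2_slice_x[OF assms, of y] poly_integrable by auto

lemma square_eq_cbox: "{-1..1} \<times> {-1..1} = cbox (-1, -1) (1 :: real, 1 :: real)"
  by (simp add: cbox_Pair_eq)

lemma cell_avg_iterated:
  assumes "p \<in> polys2 k"
  shows "cell_avg p = 1/4 * integral {-1..1} (\<lambda>x. integral {-1..1} (p x))"
  using integral_prod_continuous[OF continuous_on_polys2[OF assms], of "-1" "-1" 1 1]
  by (simp add: cell_avg_def square_eq_cbox)

lemma cell_avg_swap:
  assumes "p \<in> polys2 k"
  shows "cell_avg (\<lambda>x y. p y x) = cell_avg p"
proof -
  have "continuous_on (cbox (-1, -1) (1, 1)) (\<lambda>(x, y). p x y)"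
    using continuous_on_polys2[OF assms] by (simp add: case_prod_unfold)
  from integral_swap_continuous[OF this] show ?thesis
    by (simp add: cell_avg_iterated[OF assms] cell_avg_iterated[OF polys2_swap[OF assms]])
qed

text \<open>For fixed x the Lobatto rule evaluates the inner integral over y. Its end point terms,
  integrated exactly over x, form \<open>avg_y\<close>; on each interior Lobatto line the Gauss rule
  evaluates the integral over x.\<close>

lemma lobatto_gauss_exact:
  assumes "n \<ge> 2" "k \<le> 2 * n - 3" "k < 2 * m" "p \<in> polys2 k"
  shows "cell_avg p = 2 * om_GL n 1 * avg_y p + (\<Sum>y\<in>lobatto_interior n. \<Sum>x\<in>gauss_set m.
      node_weight (lobatto_set n) y * node_weight (gauss_set m) x * p x y)"
proof -
  let ?I = "lobatto_interior n" and ?v = "node_weight (lobatto_set n)"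
  note intg = polys2_integrable[OF assms(4)]
  have y: "integral {-1..1} (p x) = 2 * om_GL n 1 * (p x (-1) + p x 1) + (\<Sum>y\<in>?I. 2 * ?v y * p x y)" for x
  proof -
    obtain q where q: "degree q \<le> k" "p x = poly q" using polys2_slice_y[OF assms(4)] by blast
    then have "1/2 * poly_int q = om_GL n 1 * (poly q (-1) + poly q 1) + (\<Sum>y\<in>?I. ?v y * poly q y)"
      using assms by (intro lobatto_exact_split) auto
    then have "poly_int q = 2 * om_GL n 1 * (poly q (-1) + poly q 1) + 2 * (\<Sum>y\<in>?I. ?v y * poly q y)"
      by simp
    then show ?thesis by (simp add: q poly_int_def sum_distrib_left mult_ac)
  qed
  have x: "integral {-1..1} (\<lambda>x. p x y) = 2 * (\<Sum>x\<in>gauss_set m. node_weight (gauss_set m) x * p x y)" for y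
  proof -
    obtain q where q: "degree q \<le> k" "(\<lambda>x. p x y) = poly q" using polys2_slice_x[OF assms(4)] by blast
    then have "1/2 * poly_int q = (\<Sum>x\<in>gauss_set m. node_weight (gauss_set m) x * poly q x)"
      using assms by (intro gauss_exact) auto
    then show ?thesis unfolding poly_int_def q(2)[symmetric] by simp
  qed
  have fin: "finite ?I" using lobatto_interior_props assms(1) by blast
  have "cell_avg p = 1/4 * integral {-1..1}
      (\<lambda>x. 2 * om_GL n 1 * (p x (-1) + p x 1) + (\<Sum>y\<in>?I. 2 * ?v y * p x y))"
    unfolding cell_avg_iterated[OF assms(4)] y ..
  also have "integral {-1..1} (\<lambda>x. 2 * om_GL n 1 * (p x (-1) + p x 1) + (\<Sum>y\<in>?I. 2 * ?v y * p x y))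
      = 2 * om_GL n 1 * integral {-1..1} (\<lambda>x. p x (-1) + p x 1)
        + (\<Sum>y\<in>?I. 2 * ?v y * integral {-1..1} (\<lambda>x. p x y))"
    by (subst integral_add)
       (auto intro!: integrable_add integrable_sum integrable_on_mult_right intg fin simp: integral_sum[OF fin integrable_on_mult_right[OF intg]])
  finally show ?thesis
    by (simp add: avg_y_def x sum_distrib_left algebra_simps)
qed

section \<open>Optimality criterion, exchange of axes and convex combinations\<close>

lemma is_ocadI:
  assumes "feasible_cad \<theta> k w A" "\<And>wb B. feasible_cad \<theta> k wb B \<Longrightarrow> wb \<le> w"
  shows "is_ocad \<theta> k A"
proof -
  have "omega_star \<theta> k = w"
    unfolding omega_star_def using assms by (intro Greatest_equality) auto
  then show ?thesis using assms by (auto simp: is_ocad_def)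
qed

definition swap_cad :: "cad \<Rightarrow> cad" where
  "swap_cad A = \<lparr> coef_x = coef_y A, coef_y = coef_x A, internal = (\<lambda>p. internal A (\<lambda>x y. p y x)) \<rparr>"

lemma feasible_swap_cad:
  assumes "feasible_cad \<theta> k w A"
  shows "feasible_cad (-\<theta>) k w (swap_cad A)"
proof -
  obtain S v X Y where S: "sym_nodes S v X Y" "\<And>p. internal A p = sym_sum S v X Y p"
    using assms by (auto simp: feasible_cad_def)
  have "sym_nodes S v Y X" using S(1) by (auto simp: sym_nodes_def)
  moreover have "internal (swap_cad A) p = sym_sum S v Y X p" for p
    by (simp add: swap_cad_def S(2) sym_sum_def refl_avg_def add_ac)
  moreover have "cell_avg p = cad_rhs (swap_cad A) p" if "p \<in> polys2 k" for p
  proof -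
    have "cell_avg (\<lambda>x y. p y x) = cad_rhs A (\<lambda>x y. p y x)"
      using assms polys2_swap[OF that] by (auto simp: feasible_cad_def)
    then show ?thesis
      by (simp add: cell_avg_swap[OF that] cad_rhs_def swap_cad_def avg_x_def avg_y_def)
  qed
  ultimately show ?thesis
    using assms unfolding feasible_cad_def by (auto simp: swap_cad_def)
qed

lemma is_ocad_swap_cad:
  assumes "is_ocad \<theta> k A"
  shows "is_ocad (-\<theta>) k (swap_cad A)"
proof (rule is_ocadI)
  show "feasible_cad (-\<theta>) k (omega_star \<theta> k) (swap_cad A)"
    using assms feasible_swap_cad by (auto simp: is_ocad_def)
  show "wb \<le> omega_star \<theta> k" if "feasible_cad (-\<theta>) k wb B" for wb B
    using assms feasible_swap_cad[OF that] by (auto simp: is_ocad_def)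
qed

text \<open>The boundary coefficients are w + w \<theta> and w - w \<theta>, so a decomposition
  depends linearly on the pair (w, w \<theta>). The last two hypotheses combine exactly these two
  quantities.\<close>

lemma feasible_conv_comb:
  assumes A: "feasible_cad \<theta>\<^sub>1 k w\<^sub>1 A" and B: "feasible_cad \<theta>\<^sub>2 k w\<^sub>2 B" and t: "t \<in> {0..1}"
    and w: "w = t * w\<^sub>1 + (1 - t) * w\<^sub>2" and \<theta>: "w * \<theta> = t * w\<^sub>1 * \<theta>\<^sub>1 + (1 - t) * w\<^sub>2 * \<theta>\<^sub>2"
  shows "feasible_cad \<theta> k w (conv_comb t A B)"
proof -
  have pos: "w\<^sub>1 > 0" "w\<^sub>2 > 0" using A B by (auto simp: feasible_cad_def)
  have "w > 0"
    using pos t by (cases "t = 0") (auto simp: w intro!: add_pos_nonneg)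
  moreover have "is_sym_sum (internal (conv_comb t A B))"
    using is_sym_sum_convex[OF _ _ t, of "internal A" "internal B"] A B
    by (auto simp: feasible_cad_def is_sym_sum_def conv_comb_def)
  moreover have "cell_avg p = cad_rhs (conv_comb t A B) p" if "p \<in> polys2 k" for p
  proof -
    have "cell_avg p = cad_rhs A p" "cell_avg p = cad_rhs B p"
      using A B that by (auto simp: feasible_cad_def)
    then have "cell_avg p = t * cad_rhs A p + (1 - t) * cad_rhs B p"
      by (simp add: algebra_simps)
    then show ?thesis by (simp add: cad_rhs_def conv_comb_def algebra_simps)
  qed
  moreover have "coef_x (conv_comb t A B) = w * (1 + \<theta>)" "coef_y (conv_comb t A B) = w * (1 - \<theta>)"
  proof -
    have coefs: "coef_x A = w\<^sub>1 * (1 + \<theta>\<^sub>1)" "coef_y A = w\<^sub>1 * (1 - \<theta>\<^sub>1)"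
        "coef_x B = w\<^sub>2 * (1 + \<theta>\<^sub>2)" "coef_y B = w\<^sub>2 * (1 - \<theta>\<^sub>2)"
      using A B by (auto simp: feasible_cad_def)
    have "coef_x (conv_comb t A B) = w + w * \<theta>" "coef_y (conv_comb t A B) = w - w * \<theta>"
      unfolding \<theta> unfolding w by (simp_all add: conv_comb_def coefs algebra_simps)
    then show "coef_x (conv_comb t A B) = w * (1 + \<theta>)" "coef_y (conv_comb t A B) = w * (1 - \<theta>)"
      by (simp_all add: algebra_simps)
  qed
  ultimately show ?thesis unfolding feasible_cad_def is_sym_sum_def by blast
qed

section \<open>The Lobatto-Gauss decomposition and its optimality\<close>

definition lobatto_gauss_cad :: "nat \<Rightarrow> nat \<Rightarrow> cad" where
  "lobatto_gauss_cad n m = \<lparr> coef_x = 0, coef_y = 2 * om_GL n 1,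
     internal = (\<lambda>p. \<Sum>l = 2..n - 1. \<Sum>q = 1..m. om_GL n l * om_G m q * p (xi_G m q) (xi_GL n l)) \<rparr>"

lemma feasible_lobatto_gauss:
  assumes "n \<ge> 2" "k \<le> 2 * n - 3" "k < 2 * m"
  shows "feasible_cad (-1) k (om_GL n 1) (lobatto_gauss_cad n m)"
proof -
  note I = lobatto_interior_props[OF assms(1)] and G = gauss_set_props[of m]
  let ?v = "node_weight (lobatto_set n)" and ?w = "node_weight (gauss_set m)"
  have "is_sym_sum (internal (lobatto_gauss_cad n m))"
  proof (rule is_sym_sumI[where K = "lobatto_interior n \<times> gauss_set m"
        and w = "\<lambda>(y, x). ?v y * ?w x" and X = "\<lambda>(y, x). \<bar>x\<bar>" and Y = "\<lambda>(y, x). \<bar>y\<bar>"])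
    show "finite (lobatto_interior n \<times> gauss_set m)" using I(1) G(1) by simp
    fix i assume "i \<in> lobatto_interior n \<times> gauss_set m"
    then obtain y x where i: "i = (y, x)" "y \<in> lobatto_interior n" "x \<in> gauss_set m" by auto
    have "?v y > 0" using i(2) by (intro lobatto_weight_pos assms) (simp add: lobatto_set_def)
    moreover have "?w x > 0" using i(3) by (rule gauss_weight_pos)
    moreover have "\<bar>x\<bar> \<le> 1" "\<bar>y\<bar> \<le> 1" using i I(3) G(3) by (auto simp: abs_le_iff less_imp_le subset_iff)
    ultimately show "(case i of (y, x) \<Rightarrow> ?v y * ?w x) \<ge> 0 \<and> (case i of (y, x) \<Rightarrow> \<bar>x\<bar>) \<in> {0..1} \<and>
        (case i of (y, x) \<Rightarrow> \<bar>y\<bar>) \<in> {0..1}"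
      by (simp add: i(1))
  next
    fix p
    have "internal (lobatto_gauss_cad n m) p
        = (\<Sum>y\<in>lobatto_interior n. \<Sum>x\<in>gauss_set m. ?v y * ?w x * p x y)"
      by (simp only: lobatto_gauss_cad_def cad.simps lobatto_gauss_sum_eq[OF assms(1)])
    also have "\<dots> = (\<Sum>y\<in>lobatto_interior n. \<Sum>x\<in>gauss_set m. ?v y * ?w x * refl_avg p \<bar>x\<bar> \<bar>y\<bar>)"
      by (intro sum_product_refl_avg I G node_weight_uminus lobatto_set_props assms)
    also have "\<dots> = (\<Sum>i\<in>lobatto_interior n \<times> gauss_set m. (case i of (y, x) \<Rightarrow> ?v y * ?w x) *
        refl_avg p (case i of (y, x) \<Rightarrow> \<bar>x\<bar>) (case i of (y, x) \<Rightarrow> \<bar>y\<bar>))"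
      by (simp add: sum.cartesian_product case_prod_unfold)
    finally show "internal (lobatto_gauss_cad n m) p = \<dots>" .
  qed
  moreover have "cell_avg p = cad_rhs (lobatto_gauss_cad n m) p" if "p \<in> polys2 k" for p
    unfolding cad_rhs_def lobatto_gauss_cad_def cad.simps lobatto_gauss_sum_eq[OF assms(1)]
    using lobatto_gauss_exact[OF assms that] by simp
  ultimately show ?thesis
    using om_GL_first(3)[OF assms(1)]
    by (auto simp: feasible_cad_def is_sym_sum_def lobatto_gauss_cad_def)
qed

text \<open>Test with the square of the interior nodal polynomial in y, of degree at most 2n - 4.
  The internal nodes of \<open>B\<close> contribute nonnegatively, so its boundary part is at most
  the cell average; the Lobatto rule expresses that average by its end point terms alone.\<close>

lemma feasible_weight_le:
  assumes "n \<ge> 2" "2 * n - 4 \<le> k" "feasible_cad (-1) k wb B"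
  shows "wb \<le> om_GL n 1"
proof -
  note I = lobatto_interior_props[OF assms(1)]
  define f where "f = node_square (lobatto_interior n)"
  have df: "degree f \<le> 2 * n - 4"
    using degree_node_square[of "lobatto_interior n"] I(2) by (simp add: f_def)
  have p: "(\<lambda>x. poly f) \<in> polys2 k" using df assms(2) by (intro polys2_of_poly) auto
  obtain S w X Y where S: "sym_nodes S w X Y" "\<And>p. internal B p = sym_sum S w X Y p"
    using assms(3) by (auto simp: feasible_cad_def)
  have "internal B (\<lambda>x. poly f) \<ge> 0"
    using S(1) unfolding S(2) sym_sum_def refl_avg_def f_def sym_nodes_def
    by (intro sum_nonneg mult_nonneg_nonneg add_nonneg_nonneg poly_node_square_nonneg) (auto intro: less_imp_le)
  moreover have "cell_avg (\<lambda>x. poly f) = 2 * wb * avg_y (\<lambda>x. poly f) + internal B (\<lambda>x. poly f)"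
    using assms(3) p by (simp add: feasible_cad_def cad_rhs_def)
  moreover have "avg_y (\<lambda>x. poly f) = 1/2 * (poly f (-1) + poly f 1)"
    by (simp add: avg_y_def)
  ultimately have "wb * (poly f (-1) + poly f 1) \<le> cell_avg (\<lambda>x. poly f)" by simp
  also have "\<dots> = 1/2 * poly_int f"
    by (simp add: cell_avg_iterated[OF p] poly_int_def)
  also have "\<dots> = om_GL n 1 * (poly f (-1) + poly f 1)"
    using df assms(1) I(1) by (subst lobatto_exact_split[OF assms(1)]) (auto simp: f_def poly_node_square intro!: sum.neutral)
  finally have "wb * (poly f (-1) + poly f 1) \<le> om_GL n 1 * (poly f (-1) + poly f 1)" .
  moreover have "poly f (-1) > 0" "poly f 1 > 0"
    using I(1,3) by (auto simp: f_def intro!: poly_node_square_pos)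
  ultimately show ?thesis by (simp add: mult_le_cancel_right)
qed

theorem theorem6p1:
  fixes k L Q S0 :: nat and \<theta> \<tau> wstar0 wQ :: real
    and w0 X0 Y0 :: "nat \<Rightarrow> real" and A0 Am1 A1 :: cad
  assumes k: "k \<ge> 1"
    and theta: "\<theta> \<in> {-1..1}"
    and L: "int L = \<lceil>(real k + 3) / 2\<rceil>"
    and Q: "real Q \<ge> (real k + 1) / 2"
    and wstar0: "wstar0 = omega_star 0 k"
    and nodes0: "sym_nodes S0 w0 X0 Y0"
    and A0: "A0 = \<lparr> coef_x = wstar0, coef_y = wstar0,
                    internal = (\<lambda>p. \<Sum>s = 1..S0. w0 s * refl_avg p (X0 s) (Y0 s)) \<rparr>"
    and ocad0: "is_ocad 0 k A0"
    and Am1: "Am1 = \<lparr> coef_x = 0, coef_y = 2 * om_GL L 1,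
                      internal = (\<lambda>p. \<Sum>l = 2..L - 1. \<Sum>q = 1..Q.
                        om_GL L l * om_G Q q * p (xi_G Q q) (xi_GL L l)) \<rparr>"
    and A1: "A1 = \<lparr> coef_x = 2 * om_GL L 1, coef_y = 0,
                    internal = (\<lambda>p. \<Sum>l = 2..L - 1. \<Sum>q = 1..Q.
                      om_GL L l * om_G Q q * p (xi_GL L l) (xi_G Q q)) \<rparr>"
    and tau: "\<tau> = wstar0 * \<bar>\<theta>\<bar> / (wstar0 * \<bar>\<theta>\<bar> + om_GL L 1 * (1 - \<bar>\<theta>\<bar>))"
    and wQ: "wQ = wstar0 * om_GL L 1 / (wstar0 * \<bar>\<theta>\<bar> + om_GL L 1 * (1 - \<bar>\<theta>\<bar>))"
  shows "is_ocad (-1) k Am1 \<and> is_ocad 1 k A1 \<and> \<tau> \<in> {0..1} \<and>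
    (\<theta> \<in> {-1..0} \<longrightarrow>
      feasible_cad \<theta> k wQ (conv_comb \<tau> Am1 A0) \<and>
      (\<forall>p. cad_rhs (conv_comb \<tau> Am1 A0) p =
         wQ * ((1 + \<theta>) * avg_x p + (1 - \<theta>) * avg_y p)
         + \<tau> * (\<Sum>l = 2..L - 1. \<Sum>q = 1..Q.
             om_GL L l * om_G Q q * p (xi_G Q q) (xi_GL L l))
         + (1 - \<tau>) * (\<Sum>s = 1..S0. w0 s * refl_avg p (X0 s) (Y0 s))) \<and>
      (\<forall>p\<in>polys2 k. cell_avg p =
         wQ * ((1 + \<theta>) * avg_x p + (1 - \<theta>) * avg_y p)
         + \<tau> * (\<Sum>l = 2..L - 1. \<Sum>q = 1..Q.
             om_GL L l * om_G Q q * p (xi_G Q q) (xi_GL L l))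
         + (1 - \<tau>) * (\<Sum>s = 1..S0. w0 s * refl_avg p (X0 s) (Y0 s)))) \<and>
    (\<theta> \<in> {0..1} \<longrightarrow>
      feasible_cad \<theta> k wQ (conv_comb \<tau> A1 A0) \<and>
      (\<forall>p. cad_rhs (conv_comb \<tau> A1 A0) p =
         wQ * ((1 + \<theta>) * avg_x p + (1 - \<theta>) * avg_y p)
         + \<tau> * (\<Sum>l = 2..L - 1. \<Sum>q = 1..Q.
             om_GL L l * om_G Q q * p (xi_GL L l) (xi_G Q q))
         + (1 - \<tau>) * (\<Sum>s = 1..S0. w0 s * refl_avg p (X0 s) (Y0 s))) \<and>
      (\<forall>p\<in>polys2 k. cell_avg p =
         wQ * ((1 + \<theta>) * avg_x p + (1 - \<theta>) * avg_y p)
         + \<tau> * (\<Sum>l = 2..L - 1. \<Sum>q = 1..Q.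
             om_GL L l * om_G Q q * p (xi_GL L l) (xi_G Q q))
         + (1 - \<tau>) * (\<Sum>s = 1..S0. w0 s * refl_avg p (X0 s) (Y0 s))))"
proof -
  \<comment> \<open>The ceiling means k + 3 \<le> 2L < k + 5: the Lobatto rule is exact in degree k,
    and the squared nodal polynomial of degree at most 2L - 4 is an admissible test.\<close>
  have nk: "L \<ge> 2" "k \<le> 2 * L - 3" "2 * L - 4 \<le> k" "k < 2 * Q"
  proof -
    have "real (k + 3) \<le> real (2 * L)" "real (2 * L) < real (k + 5)"
      using ceiling_correct[of "(real k + 3) / 2"] L[symmetric] by (simp_all add: field_simps)
    then have "k + 3 \<le> 2 * L" "2 * L < k + 5" by (simp_all only: of_nat_le_iff of_nat_less_iff)
    then show "L \<ge> 2" "k \<le> 2 * L - 3" "2 * L - 4 \<le> k" using k by linarith+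
    show "k < 2 * Q"
    proof -
      have "real (k + 1) \<le> real (2 * Q)" using Q by simp
      then have "k + 1 \<le> 2 * Q" by (simp only: of_nat_le_iff)
      then show ?thesis by simp
    qed
  qed
  have Am1': "Am1 = lobatto_gauss_cad L Q" by (simp add: Am1 lobatto_gauss_cad_def)
  have A1': "A1 = swap_cad Am1" by (simp add: A1 Am1 swap_cad_def)
  have fm1: "feasible_cad (-1) k (om_GL L 1) Am1"
    unfolding Am1' using nk by (intro feasible_lobatto_gauss)
  have om1: "is_ocad (-1) k Am1"
    using fm1 feasible_weight_le[OF nk(1,3)] by (rule is_ocadI)
  have f1: "feasible_cad 1 k (om_GL L 1) A1"
    using feasible_swap_cad[OF fm1] by (simp add: A1')
  have o1: "is_ocad 1 k A1"
    using is_ocad_swap_cad[OF om1] by (simp add: A1')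
  have f0: "feasible_cad 0 k wstar0 A0"
    using ocad0 by (simp add: is_ocad_def wstar0)
  define d where "d = wstar0 * \<bar>\<theta>\<bar> + om_GL L 1 * (1 - \<bar>\<theta>\<bar>)"
  have pos: "wstar0 > 0" "om_GL L 1 > 0" using f0 fm1 by (auto simp: feasible_cad_def)
  have abs: "\<bar>\<theta>\<bar> \<le> 1" using theta by auto
  have d: "d > 0"
    using pos abs unfolding d_def
    by (cases "\<theta> = 0") (auto intro!: add_pos_nonneg mult_nonneg_nonneg)
  have \<tau>: "\<tau> = wstar0 * \<bar>\<theta>\<bar> / d" "1 - \<tau> = om_GL L 1 * (1 - \<bar>\<theta>\<bar>) / d"
    using d by (simp_all add: tau d_def field_simps)
  have "\<tau> \<ge> 0" unfolding \<tau> using pos d by simp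
  moreover have "1 - \<tau> \<ge> 0" unfolding \<tau>(2) using pos d abs by simp
  ultimately have \<tau>01: "\<tau> \<in> {0..1}" by simp
  have wQ': "wQ = wstar0 * om_GL L 1 / d" by (simp add: wQ d_def)
  \<comment> \<open>With the two fractions for \<tau> and 1 - \<tau>, both summands have numerator
    \<open>wstar0 * om_GL L 1\<close>, times |\<theta>| and 1 - |\<theta>|. Unfolding
    \<open>\<tau>(2)\<close> first keeps \<open>\<tau>(1)\<close> from rewriting inside 1 -
    \<tau>.\<close>
  have w: "wQ = \<tau> * om_GL L 1 + (1 - \<tau>) * wstar0"
    unfolding wQ' \<tau>(2) unfolding \<tau>(1) by (simp add: add_divide_distrib[symmetric] algebra_simps)
  \<comment> \<open>Both signs of \<theta> are treated together: \<sigma> is the parameter of the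
    Lobatto-Gauss decomposition, and |\<theta>| \<sigma> = \<theta> holds with \<sigma> = -1 for
    \<theta> \<le> 0 and with \<sigma> = 1 for \<theta> \<ge> 0.\<close>
  have conv: "feasible_cad \<theta> k wQ (conv_comb \<tau> A A0) \<and>
      (\<forall>p. cad_rhs (conv_comb \<tau> A A0) p = wQ * ((1 + \<theta>) * avg_x p + (1 - \<theta>) * avg_y p)
         + \<tau> * internal A p + (1 - \<tau>) * internal A0 p) \<and>
      (\<forall>p\<in>polys2 k. cell_avg p = wQ * ((1 + \<theta>) * avg_x p + (1 - \<theta>) * avg_y p)
         + \<tau> * internal A p + (1 - \<tau>) * internal A0 p)"
    if "feasible_cad \<sigma> k (om_GL L 1) A" "\<bar>\<theta>\<bar> * \<sigma> = \<theta>" for \<sigma> A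
  proof -
    \<comment> \<open>The second linear condition: \<open>A0\<close> has parameter 0, so only the
      Lobatto-Gauss term enters the product of weight and parameter.\<close>
    have "wQ * \<theta> = \<tau> * om_GL L 1 * \<sigma>"
      unfolding wQ' \<tau>(1) using that(2) by (metis (no_types, lifting) mult.assoc mult.commute times_divide_eq_left)
    then have feas: "feasible_cad \<theta> k wQ (conv_comb \<tau> A A0)"
      by (intro feasible_conv_comb[OF that(1) f0 \<tau>01 w]) simp
    then have "coef_x (conv_comb \<tau> A A0) = wQ * (1 + \<theta>)" "coef_y (conv_comb \<tau> A A0) = wQ * (1 - \<theta>)"
      by (auto simp: feasible_cad_def)
    moreover have "internal (conv_comb \<tau> A A0) p = \<tau> * internal A p + (1 - \<tau>) * internal A0 p" for p
      by (simp add: conv_comb_def)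
    ultimately have "cad_rhs (conv_comb \<tau> A A0) p = wQ * ((1 + \<theta>) * avg_x p + (1 - \<theta>) * avg_y p)
         + \<tau> * internal A p + (1 - \<tau>) * internal A0 p" for p
      unfolding cad_rhs_def by (simp add: distrib_left mult.assoc)
    with feas show ?thesis by (auto simp: feasible_cad_def)
  qed
  have i0: "internal A0 p = (\<Sum>s = 1..S0. w0 s * refl_avg p (X0 s) (Y0 s))" for p
    by (simp add: A0)
  have im1: "internal Am1 p = (\<Sum>l = 2..L - 1. \<Sum>q = 1..Q. om_GL L l * om_G Q q * p (xi_G Q q) (xi_GL L l))" for p
    by (simp add: Am1)
  have i1: "internal A1 p = (\<Sum>l = 2..L - 1. \<Sum>q = 1..Q. om_GL L l * om_G Q q * p (xi_GL L l) (xi_G Q q))" for p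
    by (simp add: A1)
  have "\<theta> \<in> {-1..0} \<Longrightarrow> \<bar>\<theta>\<bar> * (-1) = \<theta>" "\<theta> \<in> {0..1} \<Longrightarrow> \<bar>\<theta>\<bar> * 1 = \<theta>" by auto
  note neg = conv[OF fm1 this(1), unfolded im1 i0] and nonneg = conv[OF f1 this(2), unfolded i1 i0]
  show ?thesis
    by (intro conjI[OF om1] conjI[OF o1] conjI[OF \<tau>01] conjI[OF impI[OF neg] impI[OF nonneg]])
qed

end
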